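(* Let $f:\mathbb{H}\to\mathbb{H}$ and $g:\mathbb{H}\to\mathbb{R}$ be functions that have left GHR derivatives. Then for every $\mu\in\mathbb{H}$, $\mu\neq0$, their product $fg$ satisfies the traditional product rule $$\frac{\partial (fg)}{\partial q^{\mu}}=f\,\frac{\partial g}{\partial q^{\mu}}+\frac{\partial f}{\partial q^{\mu}}\,g,\qquad \frac{\partial (fg)}{\partial q^{\mu*}}=f\,\frac{\partial g}{\partial q^{\mu*}}+\frac{\partial f}{\partial q^{\mu*}}\,g .$$
   Context: $\mathbb{H}$ denotes the real quaternions $q=q_a+iq_b+jq_c+kq_d$ with $q_a,q_b,q_c,q_d\in\mathbb{R}$ and $i^2=j^2=k^2=ijk=-1$. For $\mu\in\mathbb{H}$, $\mu\ne0$, and $p\in\mathbb{H}$, write $p^{\mu}:=\mu p\mu^{-1}$. An $\mathbb{H}$-valued (in particular, real-valued) function $f$ is regarded as a function of the four real variables $q_a,q_b,q_c,q_d$, and $\frac{\partial f}{\partial q_a},\dots,\frac{\partial f}{\partial q_d}$ are its ($\mathbb{H}$-valued, componentwise) partial derivatives; $f$ has left GHR derivatives when these partial derivatives exist. For $\mu\neq0$ the left GHR derivatives of $f$ are $$\frac{\partial f}{\partial q^{\mu}}=\frac14\left(\frac{\partial f}{\partial q_a}-\frac{\partial f}{\partial q_b}i^{\mu}-\frac{\partial f}{\partial q_c}j^{\mu}-\frac{\partial f}{\partial q_d}k^{\mu}\right),\qquad \frac{\partial f}{\partial q^{\mu*}}=\frac14\left(\frac{\partial f}{\partial q_a}+\frac{\partial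 f}{\partial q_b}i^{\mu}+\frac{\partial f}{\partial q_c}j^{\mu}+\frac{\partial f}{\partial q_d}k^{\mu}\right).$$ *)

theory Defs
  imports "HOL-Analysis.Analysis"
begin

datatype quat = Quat (qa: real) (qb: real) (qc: real) (qd: real)

lemma quat_eq_iff:
  "p = q \<longleftrightarrow> qa p = qa q \<and> qb p = qb q \<and> qc p = qc q \<and> qd p = qd q"
  by (cases p; cases q) simp

instantiation quat :: real_div_algebra
begin

definition "0 = Quat 0 0 0 0"

definition "1 = Quat 1 0 0 0"

definition "p + q = Quat (qa p + qa q) (qb p + qb q) (qc p + qc q) (qd p + qd q)"

definition "- p = Quat (- qa p) (- qb p) (- qc p) (- qd p)"

definition "(p::quat) - q = p + - q"

definition "r *\<^sub>R p = Quat (r * qa p) (r * qb p) (r * qc p) (r * qd p)"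

definition "p * q = Quat
  (qa p * qa q - qb p * qb q - qc p * qc q - qd p * qd q)
  (qa p * qb q + qb p * qa q + qc p * qd q - qd p * qc q)
  (qa p * qc q - qb p * qd q + qc p * qa q + qd p * qb q)
  (qa p * qd q + qb p * qc q - qc p * qb q + qd p * qa q)"

definition "inverse p =
  inverse ((qa p)\<^sup>2 + (qb p)\<^sup>2 + (qc p)\<^sup>2 + (qd p)\<^sup>2) *\<^sub>R Quat (qa p) (- qb p) (- qc p) (- qd p)"

definition "(p::quat) div q = p * inverse q"

lemmas quat_ops = zero_quat_def one_quat_def plus_quat_def uminus_quat_def minus_quat_def
  scaleR_quat_def times_quat_def

instance
proof
  fix p :: quat
  assume "p \<noteq> 0"
  define n where "n = (qa p)\<^sup>2 + (qb p)\<^sup>2 + (qc p)\<^sup>2 + (qd p)\<^sup>2"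
  have "n \<noteq> 0"
  proof
    assume "n = 0"
    then have "qa p = 0 \<and> qb p = 0 \<and> qc p = 0 \<and> qd p = 0"
      unfolding n_def by (simp add: add_nonneg_eq_0_iff)
    with \<open>p \<noteq> 0\<close> show False
      by (simp add: quat_eq_iff zero_quat_def)
  qed
  moreover have "inverse p * p = (inverse n * n) *\<^sub>R 1" "p * inverse p = (inverse n * n) *\<^sub>R 1"
    unfolding inverse_quat_def n_def[symmetric]
    by (simp_all add: quat_eq_iff quat_ops) (simp_all add: n_def algebra_simps power2_eq_square)
  ultimately show "inverse p * p = 1" "p * inverse p = 1"
    by (simp_all add: quat_eq_iff quat_ops)
qed (simp_all add: quat_eq_iff quat_ops inverse_quat_def divide_quat_def algebra_simps)

end

definition qi :: quat where "qi = Quat 0 1 0 0"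

definition qj :: quat where "qj = Quat 0 0 1 0"

definition qk :: quat where "qk = Quat 0 0 0 1"

lemma quat_units: "qi\<^sup>2 = -1" "qj\<^sup>2 = -1" "qk\<^sup>2 = -1" "qi * qj * qk = -1"
  by (simp_all add: power2_eq_square quat_eq_iff quat_ops qi_def qj_def qk_def)

lemma of_real_quat: "of_real r = Quat r 0 0 0"
  by (simp add: of_real_def quat_ops)

lemma quat_decompose:
  "q = of_real (qa q) + qi * of_real (qb q) + qj * of_real (qc q) + qk * of_real (qd q)"
  by (simp add: quat_eq_iff quat_ops of_real_quat qi_def qj_def qk_def)

definition qrot :: "quat \<Rightarrow> quat \<Rightarrow> quat" where
  "qrot \<mu> p = \<mu> * p * inverse \<mu>"

text \<open>Taking \<open>e\<close> to be \<open>1\<close>, \<open>qi\<close>, \<open>qj\<close>, \<open>qk\<close> gives the componentwise partial derivatives with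
  respect to the four real variables \<open>qa\<close>, \<open>qb\<close>, \<open>qc\<close>, \<open>qd\<close>. The value of \<open>qpartial\<close> is
  meaningful only where \<open>has_qpartial\<close> holds.\<close>

definition has_qpartial :: "quat \<Rightarrow> (quat \<Rightarrow> quat) \<Rightarrow> quat \<Rightarrow> bool" where
  "has_qpartial e f q \<longleftrightarrow>
     (\<lambda>t::real. qa (f (q + t *\<^sub>R e))) differentiable (at 0) \<and>
     (\<lambda>t::real. qb (f (q + t *\<^sub>R e))) differentiable (at 0) \<and>
     (\<lambda>t::real. qc (f (q + t *\<^sub>R e))) differentiable (at 0) \<and>
     (\<lambda>t::real. qd (f (q + t *\<^sub>R e))) differentiable (at 0)"

definition qpartial :: "quat \<Rightarrow> (quat \<Rightarrow> quat) \<Rightarrow> quat \<Rightarrow> quat" where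
  "qpartial e f q = Quat
     (deriv (\<lambda>t::real. qa (f (q + t *\<^sub>R e))) 0)
     (deriv (\<lambda>t::real. qb (f (q + t *\<^sub>R e))) 0)
     (deriv (\<lambda>t::real. qc (f (q + t *\<^sub>R e))) 0)
     (deriv (\<lambda>t::real. qd (f (q + t *\<^sub>R e))) 0)"

definition has_left_GHR :: "(quat \<Rightarrow> quat) \<Rightarrow> bool" where
  "has_left_GHR f \<longleftrightarrow> (\<forall>q. \<forall>e\<in>{1, qi, qj, qk}. has_qpartial e f q)"

definition left_GHR :: "quat \<Rightarrow> (quat \<Rightarrow> quat) \<Rightarrow> quat \<Rightarrow> quat" where
  "left_GHR \<mu> f q = (1/4) *\<^sub>R
     (qpartial 1 f q - qpartial qi f q * qrot \<mu> qi
      - qpartial qj f q * qrot \<mu> qj - qpartial qk f q * qrot \<mu> qk)"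

definition left_GHR_conj :: "quat \<Rightarrow> (quat \<Rightarrow> quat) \<Rightarrow> quat \<Rightarrow> quat" where
  "left_GHR_conj \<mu> f q = (1/4) *\<^sub>R
     (qpartial 1 f q + qpartial qi f q * qrot \<mu> qi
      + qpartial qj f q * qrot \<mu> qj + qpartial qk f q * qrot \<mu> qk)"

end

theory Submission
  imports Defs
begin

text \<open>
  Each partial derivative satisfies the Leibniz rule
  \<open>\<partial>(f g) = f \<partial>g + (\<partial>f) g\<close>, because multiplying by a real-valued \<open>g\<close> multiplies each of the
  four components of \<open>f\<close> by \<open>g\<close> (lemma \<open>qpartial_mult_of_real\<close>). A GHR derivative is a
  combination of the four partial derivatives with quaternion coefficients \<open>u\<close> on the right:
  \<open>\<partial>(f g) u = f (\<partial>g u) + (\<partial>f) g u\<close>. Real numbers are central in the quaternions, so \<open>g\<close> moves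
  past \<open>u\<close> and the last term is \<open>(\<partial>f u) g\<close>; for a quaternion-valued \<open>g\<close> this exchange can fail,
  and with it the traditional product rule. The coefficients may be any quaternions here, so the
  argument is the same for every rotation \<open>\<mu>\<close> and for the conjugate derivative.
\<close>

lemma quat_sel_add:
  "qa (p + q) = qa p + qa q" "qb (p + q) = qb p + qb q"
  "qc (p + q) = qc p + qc q" "qd (p + q) = qd p + qd q"
  by (simp_all add: plus_quat_def)

lemma quat_sel_mult_of_real:
  "qa (p * of_real r) = qa p * r" "qb (p * of_real r) = qb p * r"
  "qc (p * of_real r) = qc p * r" "qd (p * of_real r) = qd p * r"
  by (simp_all add: of_real_quat times_quat_def)

lemma differentiable_mult_deriv:
  fixes u v :: "real \<Rightarrow> real"
  assumes "u differentiable (at x)" and "v differentiable (at x)"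
  shows "deriv (\<lambda>t. u t * v t) x = u x * deriv v x + deriv u x * v x"
  by (intro DERIV_imp_deriv DERIV_mult')
    (use assms in \<open>simp_all add: DERIV_deriv_iff_real_differentiable\<close>)

lemma has_qpartial_of_real_iff:
  "has_qpartial e (\<lambda>q. of_real (g q)) q \<longleftrightarrow> (\<lambda>t::real. g (q + t *\<^sub>R e)) differentiable (at 0)"
  by (simp add: has_qpartial_def of_real_quat)

lemma qpartial_of_real:
  "qpartial e (\<lambda>q. of_real (g q)) q = of_real (deriv (\<lambda>t::real. g (q + t *\<^sub>R e)) 0)"
  by (simp add: qpartial_def of_real_quat)

lemma has_qpartial_mult_of_real:
  assumes "has_qpartial e f q" and "has_qpartial e (\<lambda>q. of_real (g q)) q"
  shows "has_qpartial e (\<lambda>q. f q * of_real (g q)) q"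
  using assms
  by (simp add: has_qpartial_of_real_iff)
    (simp add: has_qpartial_def quat_sel_mult_of_real differentiable_mult)

lemma qpartial_mult_of_real:
  assumes "has_qpartial e f q" and "has_qpartial e (\<lambda>q. of_real (g q)) q"
  shows "qpartial e (\<lambda>q. f q * of_real (g q)) q
    = f q * qpartial e (\<lambda>q. of_real (g q)) q + qpartial e f q * of_real (g q)"
proof -
  have "(\<lambda>t::real. g (q + t *\<^sub>R e)) differentiable (at 0)"
    using assms(2) by (simp add: has_qpartial_of_real_iff)
  with assms(1) show ?thesis
    unfolding qpartial_of_real
    by (simp add: has_qpartial_def qpartial_def quat_eq_iff quat_sel_add
        quat_sel_mult_of_real differentiable_mult_deriv)
qed

text \<open>Centrality of the reals carries the Leibniz rule over to each term of a GHR derivative.\<close>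

lemma qpartial_mult_of_real_right:
  assumes "has_qpartial e f q" and "has_qpartial e (\<lambda>q. of_real (g q)) q"
  shows "qpartial e (\<lambda>q. f q * of_real (g q)) q * u
    = f q * (qpartial e (\<lambda>q. of_real (g q)) q * u) + (qpartial e f q * u) * of_real (g q)"
proof -
  have "of_real (g q) * u = u * of_real (g q)"
    by (simp add: of_real_def)
  then show ?thesis
    by (simp add: qpartial_mult_of_real[OF assms] distrib_right mult.assoc)
qed

theorem corollary3p3:
  fixes f :: "quat \<Rightarrow> quat" and g :: "quat \<Rightarrow> real" and \<mu> :: quat
  assumes "has_left_GHR f"
    and "has_left_GHR (\<lambda>q. of_real (g q))"
    and "\<mu> \<noteq> 0"
  shows "has_left_GHR (\<lambda>q. f q * of_real (g q)) \<and>
    (\<forall>q. left_GHR \<mu> (\<lambda>q. f q * of_real (g q)) q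
        = f q * left_GHR \<mu> (\<lambda>q. of_real (g q)) q + left_GHR \<mu> f q * of_real (g q)) \<and>
    (\<forall>q. left_GHR_conj \<mu> (\<lambda>q. f q * of_real (g q)) q
        = f q * left_GHR_conj \<mu> (\<lambda>q. of_real (g q)) q + left_GHR_conj \<mu> f q * of_real (g q))"
proof (intro conjI allI)
  have f: "has_qpartial e f q" and g: "has_qpartial e (\<lambda>q. of_real (g q)) q"
    if "e \<in> {1, qi, qj, qk}" for e q
    using assms(1,2) that unfolding has_left_GHR_def by blast+
  show "has_left_GHR (\<lambda>q. f q * of_real (g q))"
    unfolding has_left_GHR_def using f g has_qpartial_mult_of_real by blast
  fix q
  have leibniz: "qpartial e (\<lambda>q. f q * of_real (g q)) q
      = f q * qpartial e (\<lambda>q. of_real (g q)) q + qpartial e f q * of_real (g q)"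
    and leibniz_right: "qpartial e (\<lambda>q. f q * of_real (g q)) q * u
      = f q * (qpartial e (\<lambda>q. of_real (g q)) q * u) + (qpartial e f q * u) * of_real (g q)"
    if "e \<in> {1, qi, qj, qk}" for e u
    using qpartial_mult_of_real qpartial_mult_of_real_right f[OF that] g[OF that] by blast+
  show "left_GHR \<mu> (\<lambda>q. f q * of_real (g q)) q
      = f q * left_GHR \<mu> (\<lambda>q. of_real (g q)) q + left_GHR \<mu> f q * of_real (g q)"
    by (simp add: left_GHR_def leibniz[of 1] leibniz_right distrib_left distrib_right
        left_diff_distrib right_diff_distrib scaleR_add_right scaleR_diff_right)
  show "left_GHR_conj \<mu> (\<lambda>q. f q * of_real (g q)) q
      = f q * left_GHR_conj \<mu> (\<lambda>q. of_real (g q)) q + left_GHR_conj \<mu> f q * of_real (g q)"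
    by (simp add: left_GHR_conj_def leibniz[of 1] leibniz_right distrib_left distrib_right
        scaleR_add_right)
qed

end
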